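(* Let $(\alpha_k,N_k)$ be a semi-fast convergent sequence. Then: (a) $(\alpha_k,N_k)$ has a unique representation if and only if every $N_k$ is of the form $2^{n_k}-1$ with $n_k\in\mathbb{N}$; (b) $(\alpha_k,N_k)$ has a slim representation if and only if for all but finitely many $k$ the number $N_k$ is of the form $2^{n_k}-1$ with $n_k\in\mathbb{N}$.
   Context: For a summable sequence $(x_n)_{n\in\mathbb{N}}$ of positive reals, $E(x_n)=\{\sum_{n\in A}x_n:A\subset\mathbb{N}\}$. A monotonic sequence $(x_n)$ of positive reals converging to zero is semi-fast convergent if $x_n>\sum_{k:\,x_k<x_n}x_k$ for all $n\in\mathbb{N}$. Such a sequence can be written as $(\underbrace{\alpha_1,\dots,\alpha_1}_{N_1},\underbrace{\alpha_2,\dots,\alpha_2}_{N_2},\dots)$ with $(\alpha_k)$ strictly decreasing to zero, $N_k\in\mathbb{N}=\{1,2,\dots\}$, and $\alpha_k>\sum_{i>k}N_i\alpha_i$ for every $k$; it is denoted $(\alpha_k,N_k)$, and its set of subsums is $E(\alpha_k,N_k)$. A representation of $(\alpha_k,N_k)$ is a sequence $(y_n)$ of positive reals, with convergent sum, such that $E(y_n)=E(\alpha_k,N_k)$. The sequence $(\alpha_k,N_k)$ has a unique representation if there is a representation $(y_n)$ such that every $t\in E(y_n)$ equals $\sum_{n\in A}y_n$ for exactly one $A\subset\mathbb{N}$. It has a slim representation if there is a representation $(y_n)$ such that no $t\in E(y_n)$ is a $\mathfrak{c}$-point, i.e. for no $t$ does the family $\{A\subset\mathbb{N}:\sum_{n\in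 A}y_n=t\}$ have cardinality continuum. *)

theory Defs
  imports "HOL-Analysis.Analysis"
begin

text \<open>Sequences are indexed from 0, so \<open>x n\<close> is the paper's \<open>x\<^sub>n\<^sub>+\<^sub>1\<close> and \<open>N k\<close> is \<open>N\<^sub>k\<^sub>+\<^sub>1\<close>.
  For a summable sequence of positive reals, \<open>infsum x A\<close> is the unconditional sum of \<open>x n\<close> over
  \<open>n \<in> A\<close>, for every set \<open>A\<close> of indices.\<close>

definition subsums :: "(nat \<Rightarrow> real) \<Rightarrow> real set" where
  "subsums x = {infsum x A | A. True}"

text \<open>The summability clause is the convergence that the inequality tacitly asserts; without it,
  \<open>infsum\<close> would take the value 0 on divergent sums.\<close>

definition semi_fast_convergent :: "(nat \<Rightarrow> real) \<Rightarrow> bool" where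
  "semi_fast_convergent x \<longleftrightarrow>
     (\<forall>n. x n > 0) \<and> decseq x \<and> x \<longlonglongrightarrow> 0 \<and>
     (\<forall>n. x summable_on {k. x k < x n} \<and> x n > infsum x {k. x k < x n})"

text \<open>The sequence \<open>\<alpha> 0, \<dots>, \<alpha> 0, \<alpha> 1, \<dots>, \<alpha> 1, \<dots>\<close> in which \<open>\<alpha> k\<close> is repeated \<open>N k\<close> times:
  position \<open>n\<close> lies in the first block \<open>k\<close> with \<open>n < N 0 + \<dots> + N k\<close>.\<close>

definition block_seq :: "(nat \<Rightarrow> real) \<Rightarrow> (nat \<Rightarrow> nat) \<Rightarrow> nat \<Rightarrow> real" where
  "block_seq \<alpha> N n = \<alpha> (LEAST k. n < (\<Sum>i\<le>k. N i))"

text \<open>The pair \<open>(\<alpha>, N)\<close> denotes a semi-fast convergent sequence. The inequality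
  \<open>\<alpha> k > (\<Sum>i>k. N i * \<alpha> i)\<close> is the one required by \<open>semi_fast_convergent\<close> of the block sequence.\<close>

definition semi_fast_blocks :: "(nat \<Rightarrow> real) \<Rightarrow> (nat \<Rightarrow> nat) \<Rightarrow> bool" where
  "semi_fast_blocks \<alpha> N \<longleftrightarrow>
     (\<forall>i j. i < j \<longrightarrow> \<alpha> j < \<alpha> i) \<and> \<alpha> \<longlonglongrightarrow> 0 \<and> (\<forall>k. N k \<ge> 1) \<and>
     semi_fast_convergent (block_seq \<alpha> N)"

definition is_representation :: "(nat \<Rightarrow> real) \<Rightarrow> (nat \<Rightarrow> real) \<Rightarrow> (nat \<Rightarrow> nat) \<Rightarrow> bool" where
  "is_representation y \<alpha> N \<longleftrightarrow>
     (\<forall>n. y n > 0) \<and> summable y \<and> subsums y = subsums (block_seq \<alpha> N)"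

definition has_unique_representation :: "(nat \<Rightarrow> real) \<Rightarrow> (nat \<Rightarrow> nat) \<Rightarrow> bool" where
  "has_unique_representation \<alpha> N \<longleftrightarrow>
     (\<exists>y. is_representation y \<alpha> N \<and> (\<forall>t\<in>subsums y. \<exists>!A. infsum y A = t))"

definition continuum_point :: "(nat \<Rightarrow> real) \<Rightarrow> real \<Rightarrow> bool" where
  "continuum_point y t \<longleftrightarrow> eqpoll {A. infsum y A = t} (UNIV :: real set)"

definition has_slim_representation :: "(nat \<Rightarrow> real) \<Rightarrow> (nat \<Rightarrow> nat) \<Rightarrow> bool" where
  "has_slim_representation \<alpha> N \<longleftrightarrow>
     (\<exists>y. is_representation y \<alpha> N \<and> (\<forall>t\<in>subsums y. \<not> continuum_point y t))"

end

theory Submission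
  imports Defs
begin

text \<open>Since \<open>\<alpha> k\<close> exceeds the sum \<open>R (Suc k)\<close> of all later blocks, a subsum of the block sequence
  determines its digits, the numbers \<open>c k \<le> N k\<close> of copies of \<open>\<alpha> k\<close> that it uses
  (\<open>digits_unique\<close>). The gaps of the set of subsums have the lengths \<open>gap k = \<alpha> k - R (Suc k)\<close>.

  Replacing the \<open>2 ^ n - 1\<close> copies of \<open>\<alpha> k\<close> by the terms \<open>\<alpha> k, 2 * \<alpha> k, \<dots>, 2 ^ (n - 1) * \<alpha> k\<close>
  keeps the set of subsums and makes the choice of terms in block \<open>k\<close> unique; a block
  that stays as it is allows finitely many choices. This gives a unique representation if all blocks have such a
  length, and one with finite fibres if all but finitely many do (\<open>ex_representation\<close>).

  For the converse let \<open>y\<close> be any representation. A term of \<open>y\<close> need not have the form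
  \<open>j * \<alpha> k\<close> with \<open>j \<le> N k\<close>: the numbers 1, 1, 3, 4, 5 have the same subsums as
  1, 1, 3, 3, 3, 3. The structure of \<open>y\<close> is rigid, however, at the levels \<open>m\<close> where \<open>gap m\<close>
  is strictly longer than all later gaps.
  There are infinitely many such levels, because the gaps are positive and tend to zero.
  At such a level the terms of \<open>y\<close> below \<open>\<alpha> m\<close> have the total \<open>R (Suc m)\<close>
  (\<open>infsum_small_terms\<close>), and the finitely many other terms have as their subset sums exactly the
  finite subsums \<open>C (Suc m)\<close> of the blocks \<open>0, \<dots>, m\<close> (\<open>top_sums_eq_C\<close>). The set \<open>C (Suc m)\<close> has
  \<open>(N 0 + 1) * \<dots> * (N m + 1)\<close> elements. Hence, if distinct sets of terms have distinct sums, this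
  product is a power of two, and so is every \<open>N k + 1\<close>. The same count between two such
  levels shows that a block with \<open>N k + 1\<close> not a power of two forces two different finite sets of
  terms in between with equal sums. Infinitely many such collisions are combined independently
  into a subsum with continuum many representations (\<open>ex_continuum_point\<close>).\<close>

section \<open>Digit expansions and gaps\<close>

lemma ex_maximal_term:
  fixes f :: "nat \<Rightarrow> real"
  assumes "\<And>n. 0 < f n" "f \<longlonglongrightarrow> 0"
  shows "\<exists>m. \<forall>i. f i \<le> f m"
proof -
  have ev: "\<forall>\<^sub>F n in sequentially. f n < f 0" using order_tendstoD(2)[OF assms(2)] assms(1) by blast
  then have fin: "finite {n. f 0 \<le> f n}"
    unfolding cofinite_eq_sequentially[symmetric] eventually_cofinite by (simp add: not_less)
  let ?A = "{n. f 0 \<le> f n}"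
  have "Max (f ` ?A) \<in> f ` ?A" by (rule Max_in) (use fin in auto)
  then obtain m where m: "Max (f ` ?A) = f m" by auto
  have "f i \<le> f m" if "f 0 \<le> f i" for i
    unfolding m[symmetric] by (rule Max_ge) (use fin that in auto)
  then have "f i \<le> f m" for i by (meson linear order_refl order_trans)
  then show ?thesis by blast
qed

text \<open>A semi-fast convergent sequence in block form: the value \<open>\<alpha> k\<close> is available \<open>N k\<close> times and
  exceeds the sum of everything that follows its block.\<close>

locale dominating_blocks =
  fixes \<alpha> :: "nat \<Rightarrow> real" and N :: "nat \<Rightarrow> nat"
  assumes pos: "\<alpha> k > 0"
    and mult_pos: "N k \<ge> 1"
    and summable_blocks: "summable (\<lambda>k. real (N k) * \<alpha> k)"
    and dominates: "(\<Sum>i. real (N (i + Suc k)) * \<alpha> (i + Suc k)) < \<alpha> k"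
begin

text \<open>A subsum is described by its digits: \<open>c k\<close> is the number of copies of \<open>\<alpha> k\<close> used. \<open>tail c n\<close>
  is the contribution of the blocks from \<open>n\<close> on.\<close>

definition tail :: "(nat \<Rightarrow> nat) \<Rightarrow> nat \<Rightarrow> real" where
  "tail c n = (\<Sum>i. real (c (i + n)) * \<alpha> (i + n))"

text \<open>The subsums of the blocks from \<open>n\<close> on. Digit sequences are indexed absolutely, so the digits
  below \<open>n\<close> are irrelevant.\<close>

definition D :: "nat \<Rightarrow> real set" where
  "D n = {tail c n | c. \<forall>k. c k \<le> N k}"

text \<open>The total of the blocks from \<open>n\<close> on, which is the maximum of \<open>D n\<close>.\<close>

abbreviation R :: "nat \<Rightarrow> real" where
  "R \<equiv> tail N"

text \<open>The length of the interval between the maximum \<open>R (Suc k)\<close> of \<open>D (Suc k)\<close> and the next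
  subsum \<open>\<alpha> k\<close>. Every gap of \<open>D 0\<close> has one of these lengths.\<close>

definition gap :: "nat \<Rightarrow> real" where
  "gap k = \<alpha> k - R (Suc k)"

text \<open>The finite set of subsums of the first \<open>m\<close> blocks.\<close>

primrec C :: "nat \<Rightarrow> real set" where
  "C 0 = {0}"
| "C (Suc m) = {c + real j * \<alpha> m | c j. c \<in> C m \<and> j \<le> N m}"

text \<open>The gap at \<open>m\<close> is strictly longer than all later ones. The uniform bound \<open>h\<close> makes strictness
  usable for the whole tail at once.\<close>

definition record_gap :: "nat \<Rightarrow> bool" where
  "record_gap m \<longleftrightarrow> (\<exists>h>0. h < gap m \<and> (\<forall>i>m. gap i \<le> h))"

lemma summable_tail:
  assumes "\<forall>k. c k \<le> N k"
  shows "summable (\<lambda>i. real (c (i + n)) * \<alpha> (i + n))"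
proof -
  have "summable (\<lambda>k. real (c k) * \<alpha> k)"
    by (rule summable_comparison_test'[OF summable_blocks, of 0])
      (use assms pos in \<open>auto simp: abs_mult less_imp_le intro!: mult_right_mono\<close>)
  then show ?thesis by (subst summable_iff_shift)
qed

lemma tail_Suc:
  assumes "\<forall>k. c k \<le> N k"
  shows "tail c n = real (c n) * \<alpha> n + tail c (Suc n)"
  using suminf_split_head[OF summable_tail[OF assms, of n]] unfolding tail_def by simp

lemma tail_nonneg: "\<forall>k. c k \<le> N k \<Longrightarrow> 0 \<le> tail c n"
  unfolding tail_def by (rule suminf_nonneg[OF summable_tail]) (auto simp: less_imp_le pos)

lemma tail_le_R:
  assumes "\<forall>k. c k \<le> N k" shows "tail c n \<le> R n"
  unfolding tail_def
  by (rule suminf_le[OF _ summable_tail[OF assms] summable_tail])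
    (use assms in \<open>auto simp: less_imp_le pos intro!: mult_right_mono\<close>)

lemma R_Suc: "R n = real (N n) * \<alpha> n + R (Suc n)"
  by (rule tail_Suc) simp

lemma R_nonneg: "0 \<le> R n"
  by (rule tail_nonneg) simp

lemma R_less: "R (Suc n) < \<alpha> n"
  using dominates unfolding tail_def .

lemma \<alpha>_le_R: "\<alpha> n \<le> R n"
proof -
  have "1 * \<alpha> n \<le> real (N n) * \<alpha> n" using mult_pos[of n] pos[of n] by (intro mult_right_mono) auto
  then show ?thesis using R_Suc[of n] R_nonneg[of "Suc n"] by linarith
qed

lemma R_tendsto: "R \<longlonglongrightarrow> 0"
  using suminf_exist_split2[OF summable_blocks] unfolding tail_def by (simp add: add.commute)

lemma \<alpha>_tendsto: "\<alpha> \<longlonglongrightarrow> 0"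
  by (rule tendsto_sandwich[OF _ _ tendsto_const R_tendsto]) (auto simp: \<alpha>_le_R pos less_imp_le)

lemma \<alpha>_antimono: "i \<le> j \<Longrightarrow> \<alpha> j \<le> \<alpha> i"
  by (rule lift_Suc_antimono_le[of \<alpha>]) (meson R_less \<alpha>_le_R le_less_trans less_imp_le)

lemma gap_pos: "0 < gap n"
  using R_less[of n] unfolding gap_def by simp

lemma gap_tendsto: "gap \<longlonglongrightarrow> 0"
  by (rule tendsto_sandwich[OF _ _ tendsto_const \<alpha>_tendsto])
    (use gap_pos R_nonneg in \<open>auto simp: less_imp_le\<close>, simp add: gap_def R_nonneg)

lemma D_Suc: "D n = {real j * \<alpha> n + d | j d. j \<le> N n \<and> d \<in> D (Suc n)}"
proof safe
  fix x assume "x \<in> D n"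
  then obtain c where "\<forall>k. c k \<le> N k" "x = tail c n" unfolding D_def by blast
  then show "\<exists>j d. x = real j * \<alpha> n + d \<and> j \<le> N n \<and> d \<in> D (Suc n)"
    unfolding D_def using tail_Suc by blast
next
  fix j d assume j: "j \<le> N n" and "d \<in> D (Suc n)"
  then obtain c where c: "\<forall>k. c k \<le> N k" "d = tail c (Suc n)" unfolding D_def by blast
  define c' where "c' = c(n := j)"
  have c': "\<forall>k. c' k \<le> N k" using c j by (simp add: c'_def)
  have "tail c' (Suc n) = tail c (Suc n)" by (simp add: tail_def c'_def)
  then have "real j * \<alpha> n + d = tail c' n"
    unfolding tail_Suc[OF c', of n] c(2) by (simp add: c'_def)
  then show "real j * \<alpha> n + d \<in> D n" unfolding D_def using c' by blast
qed

lemma D_bounds: "x \<in> D n \<Longrightarrow> 0 \<le> x \<and> x \<le> R n"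
  unfolding D_def using tail_nonneg tail_le_R by blast

lemma R_in_D: "R n \<in> D n"
  unfolding D_def by auto

lemma zero_in_D: "0 \<in> D n"
  unfolding D_def by (auto intro!: exI[of _ "\<lambda>_. 0"] simp: tail_def)

lemma multiple_in_D: "j \<le> N n \<Longrightarrow> real j * \<alpha> n + d \<in> D n" if "d \<in> D (Suc n)"
  using that unfolding D_Suc[of n] by blast

lemma digits_unique:
  assumes "\<forall>k. c k \<le> N k" "\<forall>k. c' k \<le> N k" "tail c 0 = tail c' 0"
  shows "c = c'"
proof -
  have step: "c n = c' n \<and> tail c (Suc n) = tail c' (Suc n)" if eq: "tail c n = tail c' n" for n
  proof -
    have ne: "\<not> a n < b n"
      if "\<forall>k. a k \<le> N k" "\<forall>k. b k \<le> N k" "tail a n = tail b n" for a b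
    proof
      assume "a n < b n"
      then have "(real (a n) + 1) * \<alpha> n \<le> real (b n) * \<alpha> n"
        using pos[of n] by (intro mult_right_mono) auto
      then show False
        using tail_Suc[of a n] tail_Suc[of b n] tail_le_R[of a "Suc n"] tail_nonneg[of b "Suc n"]
          R_less[of n] that by (simp add: algebra_simps)
    qed
    have "c n = c' n"
      using ne[OF assms(1,2) eq] ne[OF assms(2,1) eq[symmetric]] by simp
    then show ?thesis using eq tail_Suc[OF assms(1), of n] tail_Suc[OF assms(2), of n] by simp
  qed
  have "tail c n = tail c' n" for n
    by (induction n) (use assms(3) step in auto)
  then show ?thesis using step by blast
qed

text \<open>Distinct translates \<open>c + D m\<close>, for \<open>c \<in> C m\<close>, have disjoint convex hulls.\<close>

lemma C_separated: "c \<in> C m \<Longrightarrow> c' \<in> C m \<Longrightarrow> c < c' \<Longrightarrow> c + R m < c'"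
proof (induction m arbitrary: c c')
  case (Suc m)
  from Suc.prems obtain a j where a: "a \<in> C m" "j \<le> N m" "c = a + real j * \<alpha> m" by auto
  from Suc.prems obtain b i where b: "b \<in> C m" "i \<le> N m" "c' = b + real i * \<alpha> m" by auto
  have top: "real k * \<alpha> m + R (Suc m) \<le> R m" if "k \<le> N m" for k
    using that pos[of m] R_Suc[of m] by (simp add: mult_right_mono less_imp_le)
  have nonneg: "0 \<le> real k * \<alpha> m" for k using pos[of m] by (simp add: less_imp_le)
  consider "a < b" | "a = b" | "b < a" by linarith
  then show ?case
  proof cases
    case 1
    then show ?thesis using Suc.IH[OF a(1) b(1)] top[OF a(2)] nonneg[of i] a(3) b(3) by linarith
  next
    case 2
    then have "j < i" using Suc.prems(3) a(3) b(3) pos[of m] by (simp add: mult_less_cancel_right)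
    then have "(real j + 1) * \<alpha> m \<le> real i * \<alpha> m" using pos[of m] by (intro mult_right_mono) auto
    then show ?thesis using 2 a(3) b(3) R_less[of m] by (simp add: algebra_simps)
  next
    case 3
    then show ?thesis
      using Suc.IH[OF b(1) a(1)] top[OF b(2)] nonneg[of j] a(3) b(3) Suc.prems(3) R_nonneg[of "Suc m"]
      by linarith
  qed
qed simp

lemma C_bounds: "c \<in> C m \<Longrightarrow> 0 \<le> c \<and> c \<le> R 0 - R m"
proof (induction m arbitrary: c)
  case (Suc m)
  then obtain a j where a: "a \<in> C m" "j \<le> N m" "c = a + real j * \<alpha> m" by auto
  have "real j * \<alpha> m \<le> real (N m) * \<alpha> m" using a(2) pos[of m] by (simp add: less_imp_le)
  then show ?case using Suc.IH[OF a(1)] a(3) R_Suc[of m] pos[of m]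
    by (smt (verit) mult_nonneg_nonneg of_nat_0_le_iff)
qed simp

lemma C_reflect: "c \<in> C m \<Longrightarrow> R 0 - R m - c \<in> C m"
proof (induction m arbitrary: c)
  case (Suc m)
  then obtain a j where a: "a \<in> C m" "j \<le> N m" "c = a + real j * \<alpha> m" by auto
  have "R 0 - R (Suc m) - c = (R 0 - R m - a) + real (N m - j) * \<alpha> m"
    using a R_Suc[of m] by (simp add: of_nat_diff algebra_simps)
  then show ?case unfolding C.simps using Suc.IH[OF a(1)]
    by (intro CollectI exI[of _ "R 0 - R m - a"] exI[of _ "N m - j"]) simp
qed simp

lemma zero_in_C: "0 \<in> C m"
  by (induction m) (force intro!: exI[of _ 0])+

lemma D0_split: "D 0 = {c + d | c d. c \<in> C m \<and> d \<in> D m}"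
proof (induction m)
  case (Suc m)
  show ?case unfolding Suc.IH D_Suc[of m] C.simps
    by (auto; metis add.assoc)
qed simp

lemma C_add_D: "c \<in> C m \<Longrightarrow> d \<in> D m \<Longrightarrow> c + d \<in> D 0"
  using D0_split[of m] by blast

lemma card_C: "card (C m) = (\<Prod>i<m. N i + 1)"
proof (induction m)
  case (Suc m)
  have eq: "C (Suc m) = (\<lambda>(c, j). c + real j * \<alpha> m) ` (C m \<times> {..N m})" by auto
  have "inj_on (\<lambda>(c, j). c + real j * \<alpha> m) (C m \<times> {..N m})"
  proof (rule inj_onI, clarify)
    fix c j c' j' assume *: "c \<in> C m" "j \<le> N m" "c' \<in> C m" "j' \<le> N m"
      "c + real j * \<alpha> m = c' + real j' * \<alpha> m"
    have b: "0 \<le> real k * \<alpha> m" "k \<le> N m \<Longrightarrow> real k * \<alpha> m \<le> R m" for k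
      using multiple_in_D[OF zero_in_D, of k m] D_bounds[of "real k * \<alpha> m" m] pos[of m]
      by auto
    have "c = c'"
      using C_separated[OF *(1,3)] C_separated[OF *(3,1)] b(1)[of j] b(1)[of j'] b(2)[OF *(2)]
        b(2)[OF *(4)] *(5) by linarith
    then show "c = c' \<and> j = j'" using *(5) pos[of m] by simp
  qed
  then show ?case unfolding eq using Suc.IH by (simp add: card_image card_cartesian_product)
qed simp

text \<open>The set of all subsums misses the open interval between \<open>c + j * \<alpha> m + R (Suc m)\<close> and
  \<open>c + (j + 1) * \<alpha> m\<close>, an interval of length \<open>gap m\<close>.\<close>

lemma D0_gap:
  assumes x: "x \<in> D 0" and c: "c \<in> C m" and j: "j < N m"
    and lower: "c + real j * \<alpha> m + R (Suc m) < x"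
  shows "c + real (Suc j) * \<alpha> m \<le> x"
proof (rule ccontr)
  assume "\<not> ?thesis"
  then have upper: "x < c + real (Suc j) * \<alpha> m" by simp
  obtain c' d where cd: "c' \<in> C (Suc m)" "d \<in> D (Suc m)" "x = c' + d"
    using x D0_split[of "Suc m"] by blast
  have cj: "c + real j * \<alpha> m \<in> C (Suc m)" "c + real (Suc j) * \<alpha> m \<in> C (Suc m)"
    using c j less_imp_le Suc_leI unfolding C.simps by blast+
  have "c + real j * \<alpha> m < c'" using lower cd D_bounds[OF cd(2)] by linarith
  have "c' < c + real (Suc j) * \<alpha> m" using upper cd D_bounds[OF cd(2)] by linarith
  obtain a i where a: "a \<in> C m" "i \<le> N m" "c' = a + real i * \<alpha> m" using cd by auto
  have b: "0 \<le> real k * \<alpha> m" "k \<le> N m \<Longrightarrow> real k * \<alpha> m \<le> R m" for k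
    using multiple_in_D[OF zero_in_D, of k m] D_bounds[of "real k * \<alpha> m" m] pos[of m]
    by auto
  have "a = c"
    using C_separated[OF a(1) c] C_separated[OF c a(1)] b(1)[of i] b(2)[OF a(2)] b(1)[of j]
      b(2)[of "Suc j"] j a(3) \<open>c + real j * \<alpha> m < c'\<close> \<open>c' < c + real (Suc j) * \<alpha> m\<close> by linarith
  then have "real j < real i" "real i < real (Suc j)"
    using \<open>c + real j * \<alpha> m < c'\<close> \<open>c' < c + real (Suc j) * \<alpha> m\<close> a(3) pos[of m]
    by (auto simp: mult_less_cancel_right simp del: of_nat_Suc)
  then show False by simp
qed

lemma D0_small:
  assumes "x \<in> D 0" "x < \<alpha> m"
  shows "x \<in> D (Suc m)"
proof -
  have le: "x \<le> R (Suc m)"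
    using D0_gap[OF assms(1) zero_in_C, of 0 m] mult_pos[of m] assms(2) by force
  obtain c d where cd: "c \<in> C (Suc m)" "d \<in> D (Suc m)" "x = c + d"
    using assms(1) D0_split[of "Suc m"] by blast
  have "\<not> 0 < c" using C_separated[OF zero_in_C cd(1)] le cd D_bounds[OF cd(2)] by linarith
  then have "c = 0" using C_bounds[OF cd(1)] by simp
  then show ?thesis using cd by simp
qed

text \<open>If the gaps from level \<open>n\<close> on are at most \<open>h\<close>, then \<open>D n\<close> meets every interval \<open>(a, a + h]\<close>
  with \<open>a\<close> in \<open>[0, R n)\<close>. For otherwise \<open>a\<close> lies, for every \<open>k\<close>, in the hull of some
  translate of \<open>D (n + k)\<close>, and the right end points of these hulls tend to \<open>a\<close>.\<close>

lemma D_dense: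
  assumes h: "0 < h" "\<And>i. i \<ge> n \<Longrightarrow> gap i \<le> h" and a: "0 \<le> a" "a < R n"
  shows "\<exists>x\<in>D n. a < x \<and> x \<le> a + h"
proof (rule ccontr)
  assume neg: "\<not> ?thesis"
  have block: "\<exists>c. c \<le> a \<and> a < c + R (n + k) \<and> (\<forall>d\<in>D (n + k). c + d \<in> D n)" for k
  proof (induction k)
    case 0 show ?case using a by (intro exI[of _ 0]) auto
  next
    case (Suc k)
    then obtain c where c: "c \<le> a" "a < c + R (n + k)" "\<forall>d\<in>D (n + k). c + d \<in> D n" by blast
    let ?m = "n + k"
    \<comment> \<open>The last translate of \<open>D (Suc (n + k))\<close> inside the current one that starts at or before \<open>a\<close>.\<close>
    define j where "j = Max {j. j \<le> N ?m \<and> c + real j * \<alpha> ?m \<le> a}"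
    have fin: "finite {j. j \<le> N ?m \<and> c + real j * \<alpha> ?m \<le> a}"
      by (rule finite_subset[of _ "{..N ?m}"]) auto
    have "j \<in> {j. j \<le> N ?m \<and> c + real j * \<alpha> ?m \<le> a}"
      unfolding j_def by (rule Max_in[OF fin]) (use c in \<open>auto intro: exI[of _ 0]\<close>)
    then have j: "j \<le> N ?m" "c + real j * \<alpha> ?m \<le> a" by auto
    have "a < c + real j * \<alpha> ?m + R (Suc ?m)"
    proof (rule ccontr)
      assume "\<not> ?thesis"
      then have right: "c + real j * \<alpha> ?m + R (Suc ?m) \<le> a" by simp
      then have "j \<noteq> N ?m" using c(2) R_Suc[of ?m] by auto
      then have less: "Suc j \<le> N ?m" using j by simp
      have "\<not> c + real (Suc j) * \<alpha> ?m \<le> a"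
        using Max_ge[OF fin, of "Suc j"] less unfolding j_def[symmetric] by auto
      moreover have "c + real (Suc j) * \<alpha> ?m \<le> a + h"
        using right h(2)[of ?m] unfolding gap_def by (simp add: algebra_simps)
      moreover have "c + real (Suc j) * \<alpha> ?m \<in> D n"
        using c(3) multiple_in_D[OF zero_in_D less] by simp
      ultimately show False using neg by (auto simp del: of_nat_Suc)
    qed
    then show ?case using j c(3) multiple_in_D[OF _ j(1)]
      by (intro exI[of _ "c + real j * \<alpha> ?m"]) (auto simp: add.assoc)
  qed
  obtain k where "R k < h" "n \<le> k"
    using order_tendstoD(2)[OF R_tendsto h(1)] unfolding eventually_sequentially
    by (metis linorder_linear order_refl)
  then obtain c where "c \<le> a" "a < c + R k" "c + R k \<in> D n"
    using block[of "k - n"] R_in_D[of k] by auto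
  then show False using neg \<open>R k < h\<close> by force
qed

lemma ex_record_gap: "\<exists>m\<ge>n. record_gap m"
proof -
  obtain p where p: "\<forall>i. gap (i + n) \<le> gap (p + n)"
    using ex_maximal_term[of "\<lambda>i. gap (i + n)"] gap_pos LIMSEQ_ignore_initial_segment[OF gap_tendsto] by blast
  let ?M = "gap (p + n)"
  have "\<forall>\<^sub>F i in sequentially. gap i < ?M" using order_tendstoD(2)[OF gap_tendsto gap_pos] .
  then have fin: "finite {i. ?M \<le> gap i}"
    unfolding cofinite_eq_sequentially[symmetric] eventually_cofinite by (simp add: not_less)
  \<comment> \<open>The last position at which the maximal gap from \<open>n\<close> on is attained.\<close>
  define m where "m = Max {i. ?M \<le> gap i}"
  have m: "?M \<le> gap m" "\<And>i. ?M \<le> gap i \<Longrightarrow> i \<le> m"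
    using Max_in[OF fin] Max_ge[OF fin] unfolding m_def by auto
  obtain q where q: "\<forall>i. gap (i + Suc m) \<le> gap (q + Suc m)"
    using ex_maximal_term[of "\<lambda>i. gap (i + Suc m)"] gap_pos LIMSEQ_ignore_initial_segment[OF gap_tendsto] by blast
  have "gap (q + Suc m) < gap m" using m(1) m(2)[of "q + Suc m"] by force
  moreover have "\<forall>i>m. gap i \<le> gap (q + Suc m)"
    using q by (metis Suc_leI le_add_diff_inverse2)
  ultimately have "record_gap m" unfolding record_gap_def using gap_pos by blast
  moreover have "n \<le> m" using m(2)[of "p + n"] by auto
  ultimately show ?thesis by blast
qed

end

section \<open>The structure of a representation\<close>

text \<open>A representation \<open>y\<close>: a positive summable sequence with the same set of subsums.\<close>

locale represented_blocks = dominating_blocks +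
  fixes y :: "nat \<Rightarrow> real"
  assumes y_pos: "0 < y n"
    and summable_y: "summable y"
    and subsums_y: "subsums y = D 0"
begin

abbreviation top_terms :: "nat \<Rightarrow> nat set" where
  "top_terms m \<equiv> {j. \<alpha> m \<le> y j}"

abbreviation small_terms :: "nat \<Rightarrow> nat set" where
  "small_terms m \<equiv> {j. y j < \<alpha> m}"

lemma summable_on_y: "y summable_on A"
proof -
  have "y summable_on UNIV"
    using summable_y y_pos by (simp add: summable_on_UNIV_nonneg_real_iff less_imp_le)
  then show ?thesis by (rule summable_on_subset_banach) simp
qed

lemma infsum_y_Un: "A \<inter> B = {} \<Longrightarrow> infsum y (A \<union> B) = infsum y A + infsum y B"
  by (rule infsum_Un_disjoint[OF summable_on_y summable_on_y])

lemma infsum_y_mono: "A \<subseteq> B \<Longrightarrow> infsum y A \<le> infsum y B"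
  by (rule infsum_mono2[OF summable_on_y summable_on_y]) (auto simp: less_imp_le y_pos)

lemma infsum_y_nonneg: "0 \<le> infsum y A"
  by (rule infsum_nonneg) (simp add: less_imp_le y_pos)

lemma term_le_infsum_y: "j \<in> A \<Longrightarrow> y j \<le> infsum y A"
  using infsum_y_mono[of "{j}" A] by simp

lemma infsum_y_in_D0: "infsum y A \<in> D 0"
  using subsums_y unfolding subsums_def by blast

lemma y_in_D0: "y j \<in> D 0"
  using infsum_y_in_D0[of "{j}"] by simp

lemma D0_infsum_y: "x \<in> D 0 \<Longrightarrow> \<exists>A. x = infsum y A"
  using subsums_y unfolding subsums_def by blast

lemma finite_large_terms: "0 < s \<Longrightarrow> finite {j. s \<le> y j}"
  using order_tendstoD(2)[OF summable_LIMSEQ_zero[OF summable_y], of s]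
  unfolding cofinite_eq_sequentially[symmetric] eventually_cofinite by (simp add: not_less)

lemma finite_top: "finite (top_terms m)"
  by (rule finite_large_terms[OF pos])

lemma infsum_y_tail_small:
  assumes "0 < h"
  shows "\<exists>s>0. infsum y {j. y j < s} \<le> h"
proof -
  obtain F where F: "finite F" "dist (sum y F) (infsum y UNIV) \<le> h"
    using infsum_finite_approximation[OF summable_on_y[of UNIV] assms] by blast
  have "infsum y UNIV = sum y F + infsum y (- F)"
    using infsum_y_Un[of F "- F"] F(1) by (simp add: Compl_partition)
  then have "infsum y (- F) \<le> h" using F(2) by (simp add: dist_real_def)
  define s where "s = Min (insert 1 (y ` F))"
  have "0 < s" unfolding s_def using F(1) y_pos by (subst Min_gr_iff) auto
  have "s \<le> y j" if "j \<in> F" for j unfolding s_def using F(1) that by (intro Min_le) auto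
  then have "{j. y j < s} \<subseteq> - F" by force
  then show ?thesis
    using infsum_y_mono[of "{j. y j < s}" "- F"] \<open>infsum y (- F) \<le> h\<close> \<open>0 < s\<close> by force
qed

text \<open>If no term exceeds the sum of the strictly smaller terms by more than \<open>h\<close>, then the subsums
  have no gap longer than \<open>h\<close>. The proof splits off the terms below a threshold with sum at
  most \<open>h\<close> and adds the remaining finitely many terms in increasing order.\<close>

lemma subsums_dense:
  assumes h: "0 < h"
    and closed: "\<And>j i. j \<in> J \<Longrightarrow> y i < y j \<Longrightarrow> i \<in> J"
    and step: "\<And>j. j \<in> J \<Longrightarrow> y j \<le> infsum y {i. y i < y j} + h"
    and a: "0 \<le> a" "a < infsum y J"
  shows "\<exists>A\<subseteq>J. a < infsum y A \<and> infsum y A \<le> a + h"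
proof -
  obtain s where s: "0 < s" "infsum y {j. y j < s} \<le> h" using infsum_y_tail_small[OF h] by blast
  show ?thesis using closed step a
  proof (induction "card {j \<in> J. s \<le> y j}" arbitrary: J a)
    case 0
    have "finite {j \<in> J. s \<le> y j}" by (rule finite_subset[OF _ finite_large_terms[OF s(1)]]) auto
    then have "J \<subseteq> {j. y j < s}" using "0.hyps" by (auto simp: not_le[symmetric])
    then have "infsum y J \<le> h" using infsum_y_mono s(2) order_trans by blast
    then show ?case using "0.prems" by (intro exI[of _ J]) auto
  next
    case (Suc n)
    let ?L = "{j \<in> J. s \<le> y j}"
    have fin: "finite ?L" by (rule finite_subset[OF _ finite_large_terms[OF s(1)]]) auto
    have "?L \<noteq> {}" using Suc.hyps(2) by (metis card.empty nat.distinct(1))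
    then have "Max (y ` ?L) \<in> y ` ?L" by (intro Max_in) (use fin in auto)
    then obtain x where x: "x \<in> J" "s \<le> y x" "Max (y ` ?L) = y x" by auto
    have max: "y j \<le> y x" if "j \<in> J" for j
    proof (cases "s \<le> y j")
      case True
      then show ?thesis unfolding x(3)[symmetric] by (intro Max_ge) (use fin that in auto)
    qed (use x(2) in simp)
    let ?K = "J - {x}"
    have "{j \<in> ?K. s \<le> y j} = ?L - {x}" by auto
    then have card: "n = card {j \<in> ?K. s \<le> y j}" using Suc.hyps(2) fin x by simp
    have closed: "i \<in> ?K" if "j \<in> ?K" "y i < y j" for i j
      using Suc.prems(1)[of j i] that max[of j] by auto
    have IH: "\<exists>A\<subseteq>?K. b < infsum y A \<and> infsum y A \<le> b + h" if "0 \<le> b" "b < infsum y ?K" for b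
      by (rule Suc.hyps(1)[OF card closed Suc.prems(2) that]) auto
    have J: "infsum y J = y x + infsum y ?K"
      using infsum_y_Un[of "{x}" ?K] x(1) by (simp add: insert_absorb)
    show ?case
    proof (cases "a < infsum y ?K")
      case True
      then show ?thesis using IH[OF Suc.prems(3)] by blast
    next
      case False
      have "{i. y i < y x} \<subseteq> ?K" using Suc.prems(1)[OF x(1)] by auto
      then have "y x \<le> a + h"
        using Suc.prems(2)[OF x(1)] infsum_y_mono[of "{i. y i < y x}" ?K] False by linarith
      show ?thesis
      proof (cases "a < y x")
        case True
        then show ?thesis using \<open>y x \<le> a + h\<close> x(1) by (intro exI[of _ "{x}"]) auto
      next
        case False
        then obtain A where A: "A \<subseteq> ?K" "a - y x < infsum y A" "infsum y A \<le> a - y x + h"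
          using IH[of "a - y x"] Suc.prems(4) J by auto
        have "infsum y ({x} \<union> A) = y x + infsum y A" using infsum_y_Un[of "{x}" A] A(1) by auto
        then show ?thesis using A x(1) by (intro exI[of _ "{x} \<union> A"]) auto
      qed
    qed
  qed
qed

lemma D_subset_D0: "D m \<subseteq> D 0"
  using C_add_D[OF zero_in_C] by auto

text \<open>At a record gap the small terms of a representation have exactly the total \<open>R (Suc m)\<close>. If
  they had more, their subsums would jump over the interval from \<open>R (Suc m)\<close> to \<open>\<alpha> m\<close>. Then some
  small term exceeds the sum of the smaller ones by a whole record gap, so the subsums below
  \<open>\<alpha> m\<close>, that is \<open>D (Suc m)\<close>, have a gap that \<open>D_dense\<close> rules out.\<close>

lemma infsum_small_terms:
  assumes "record_gap m"
  shows "infsum y (small_terms m) = R (Suc m)"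
proof (rule antisym)
  obtain h where h: "0 < h" "h < gap m" "\<And>i. i > m \<Longrightarrow> gap i \<le> h"
    using assms unfolding record_gap_def by blast
  have step: "y j \<le> infsum y {i. y i < y j} + h" if j: "j \<in> small_terms m" for j
  proof (rule ccontr)
    let ?W = "infsum y {i. y i < y j}"
    assume "\<not> ?thesis"
    then have less: "?W + h < y j" by simp
    have "y j \<in> D (Suc m)" using D0_small[OF y_in_D0] j by simp
    then have "?W < R (Suc m)" using D_bounds less h(1) by force
    then obtain x where x: "x \<in> D (Suc m)" "?W < x" "x \<le> ?W + h"
      using D_dense[OF h(1), of "Suc m" ?W] h(3) infsum_y_nonneg by auto
    obtain A where A: "x = infsum y A" using D0_infsum_y D_subset_D0 x(1) by blast
    have "A \<subseteq> {i. y i < y j}"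
    proof
      fix i assume "i \<in> A"
      then show "i \<in> {i. y i < y j}" using term_le_infsum_y[of i A] A x(3) less by simp
    qed
    then show False using infsum_y_mono A x(2) by (meson not_le)
  qed
  show "infsum y (small_terms m) \<le> R (Suc m)"
  proof (rule ccontr)
    assume "\<not> ?thesis"
    then have "\<exists>A\<subseteq>small_terms m. R (Suc m) < infsum y A \<and> infsum y A \<le> R (Suc m) + h"
      by (intro subsums_dense[OF h(1) _ step R_nonneg]) auto
    then obtain A where A: "R (Suc m) < infsum y A" "infsum y A \<le> R (Suc m) + h" by blast
    have "\<alpha> m \<le> infsum y A"
      using D0_gap[OF infsum_y_in_D0 zero_in_C, of 0 m A] mult_pos[of m] A(1) by simp
    then show False using A(2) h(2) unfolding gap_def by simp
  qed
  obtain A where A: "R (Suc m) = infsum y A" using D0_infsum_y R_in_D D_subset_D0 by blast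
  have "A \<subseteq> small_terms m"
  proof
    fix i assume "i \<in> A"
    then show "i \<in> small_terms m" using term_le_infsum_y[of i A] A R_less[of m] by simp
  qed
  then show "R (Suc m) \<le> infsum y (small_terms m)" using infsum_y_mono A by simp
qed

lemma sum_top_terms:
  assumes "record_gap m"
  shows "sum y (top_terms m) = R 0 - R (Suc m)"
proof -
  obtain A where "R 0 = infsum y A" using D0_infsum_y R_in_D by blast
  then have "R 0 \<le> infsum y UNIV" using infsum_y_mono[of A UNIV] by simp
  moreover have "infsum y UNIV \<le> R 0" using D_bounds infsum_y_in_D0 by blast
  moreover have "infsum y UNIV = sum y (top_terms m) + infsum y (small_terms m)"
  proof -
    have "top_terms m \<union> small_terms m = UNIV" "top_terms m \<inter> small_terms m = {}" by auto
    then show ?thesis using infsum_y_Un[of "top_terms m" "small_terms m"] finite_top by simp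
  qed
  ultimately show ?thesis using infsum_small_terms[OF assms] by simp
qed

lemma D0_top_split:
  assumes "record_gap m" "x \<in> D 0"
  shows "\<exists>B d. B \<subseteq> top_terms m \<and> d \<in> D (Suc m) \<and> x = sum y B + d"
proof -
  obtain A where A: "x = infsum y A" using D0_infsum_y assms by blast
  have "(A \<inter> top_terms m) \<union> (A \<inter> small_terms m) = A"
    "(A \<inter> top_terms m) \<inter> (A \<inter> small_terms m) = {}" by auto
  then have "x = infsum y (A \<inter> top_terms m) + infsum y (A \<inter> small_terms m)"
    using infsum_y_Un[of "A \<inter> top_terms m" "A \<inter> small_terms m"] A by simp
  moreover have "infsum y (A \<inter> small_terms m) < \<alpha> m"
    using infsum_y_mono[of "A \<inter> small_terms m" "small_terms m"] infsum_small_terms[OF assms(1)]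
      R_less[of m] by simp
  then have "infsum y (A \<inter> small_terms m) \<in> D (Suc m)" using D0_small infsum_y_in_D0 by blast
  ultimately show ?thesis using finite_top[of m] by (intro exI[of _ "A \<inter> top_terms m"]) auto
qed

lemma top_sum_add_D:
  assumes "B \<subseteq> top_terms m" "d \<in> D (Suc m)"
  shows "sum y B + d \<in> D 0"
proof -
  obtain A where A: "d = infsum y A" using D0_infsum_y D_subset_D0 assms(2) by blast
  have "A \<subseteq> small_terms m"
  proof
    fix i assume "i \<in> A"
    then show "i \<in> small_terms m"
      using term_le_infsum_y[of i A] A R_less[of m] D_bounds[OF assms(2)] by simp
  qed
  then have "B \<inter> A = {}" using assms(1) by fastforce
  then have "infsum y (B \<union> A) = sum y B + d"
    using infsum_y_Un[of B A] A finite_subset[OF assms(1) finite_top] by simp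
  then show ?thesis using infsum_y_in_D0 by metis
qed

lemma record_gap_dense:
  assumes "record_gap m" "0 \<le> a" "a < R (Suc m)"
  shows "\<exists>x\<in>D (Suc m). a < x \<and> x < a + gap m"
proof -
  obtain h where h: "0 < h" "h < gap m" "\<And>i. i > m \<Longrightarrow> gap i \<le> h"
    using assms(1) unfolding record_gap_def by blast
  then show ?thesis using D_dense[OF h(1), of "Suc m" a] assms by force
qed

text \<open>A translate of \<open>D (Suc m)\<close> starting strictly inside \<open>c + j * \<alpha> m + D (Suc m)\<close> would
  put a point into the record gap that follows, if \<open>j < N m\<close>.\<close>

lemma top_sum_not_inside:
  assumes rec: "record_gap m" and B: "B \<subseteq> top_terms m"
    and c: "c \<in> C m" "j < N m" and e: "e \<in> D (Suc m)" "0 < e"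
  shows "sum y B \<noteq> c + real j * \<alpha> m + e"
proof
  assume eq: "sum y B = c + real j * \<alpha> m + e"
  obtain x where x: "x \<in> D (Suc m)" "R (Suc m) - e < x" "x < R (Suc m) - e + gap m"
    using record_gap_dense[OF rec, of "R (Suc m) - e"] D_bounds[OF e(1)] e(2) by auto
  show False
    using D0_gap[OF top_sum_add_D[OF B x(1)] c] x eq unfolding gap_def by (simp add: algebra_simps)
qed

text \<open>A point \<open>c\<close> of \<open>C (Suc m)\<close> has a record gap on the left of \<open>c\<close>, if its last digit is positive, or on
  the right of \<open>c + R (Suc m)\<close>. In the decomposition of the end point next to the gap into a sum
  of top terms and an element \<open>d\<close> of \<open>D (Suc m)\<close>, the element \<open>d\<close> must be extreme in
  \<open>D (Suc m)\<close>, since otherwise another element moves the sum into the gap.\<close>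

lemma C_subset_top_sums:
  assumes rec: "record_gap m" and c: "c \<in> C (Suc m)"
  shows "c \<in> sum y ` Pow (top_terms m)"
proof -
  obtain c' j where j: "c' \<in> C m" "j \<le> N m" "c = c' + real j * \<alpha> m" using c by auto
  have cR: "c + d \<in> D 0" if "d \<in> D (Suc m)" for d using C_add_D[OF c that] .
  show ?thesis
  proof (cases "j = 0")
    case False
    obtain B d where B: "B \<subseteq> top_terms m" "d \<in> D (Suc m)" "c + 0 = sum y B + d"
      using D0_top_split[OF rec cR[OF zero_in_D]] by blast
    have "d = 0"
    proof (rule ccontr)
      assume "d \<noteq> 0"
      then have d: "0 < d" using D_bounds[OF B(2)] by simp
      have "\<exists>x\<in>D (Suc m). d - gap m < x \<and> x < d"
      proof (cases "0 \<le> d - gap m")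
        case True
        then show ?thesis
          using record_gap_dense[OF rec, of "d - gap m"] D_bounds[OF B(2)] gap_pos[of m] by auto
      qed (use zero_in_D d in force)
      then obtain x where x: "x \<in> D (Suc m)" "d - gap m < x" "x < d" by blast
      obtain k where k: "j = Suc k" using False by (cases j) auto
      have "c' + real k * \<alpha> m + R (Suc m) < sum y B + x"
        using x B(3) j(3) k unfolding gap_def by (simp add: algebra_simps)
      then have "c \<le> sum y B + x"
        using D0_gap[OF top_sum_add_D[OF B(1) x(1)] j(1), of k] j k by simp
      then show False using x B(3) by simp
    qed
    then show ?thesis using B by auto
  next
    case True
    then have j': "c' \<in> C m" "0 < N m" "c = c'" using j mult_pos[of m] by auto
    obtain B d where B: "B \<subseteq> top_terms m" "d \<in> D (Suc m)" "c + R (Suc m) = sum y B + d"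
      using D0_top_split[OF rec cR[OF R_in_D]] by blast
    have "d = R (Suc m)"
    proof (rule ccontr)
      assume "d \<noteq> R (Suc m)"
      then obtain x where x: "x \<in> D (Suc m)" "d < x" "x < d + gap m"
        using record_gap_dense[OF rec, of d] D_bounds[OF B(2)] by auto
      have "c' + \<alpha> m \<le> sum y B + x"
        using D0_gap[OF top_sum_add_D[OF B(1) x(1)] j'(1,2)] x B(3) j'(3) by simp
      then show False using x B(3) j'(3) unfolding gap_def by simp
    qed
    then show ?thesis using B by auto
  qed
qed

text \<open>One of the top terms, at index \<open>p\<close>, equals \<open>\<alpha> m\<close>. If a sum using \<open>p\<close> were
  \<open>c + j * \<alpha> m + e\<close> with \<open>e > 0\<close>, then \<open>j = N m\<close> by \<open>top_sum_not_inside\<close>; but dropping \<open>p\<close> gives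
  the digit \<open>j - 1\<close>, which the same lemma excludes. Sums not using \<open>p\<close> are complements of sums
  that do, and \<open>C (Suc m)\<close> is symmetric.\<close>

lemma top_sum_in_C:
  assumes rec: "record_gap m" and B: "B \<subseteq> top_terms m"
  shows "sum y B \<in> C (Suc m)"
proof -
  have "0 + real 1 * \<alpha> m \<in> C (Suc m)" using zero_in_C mult_pos[of m] unfolding C.simps by blast
  then obtain S where S: "S \<subseteq> top_terms m" "\<alpha> m = sum y S"
    using C_subset_top_sums[OF rec, of "\<alpha> m"] by (force simp del: C.simps)
  have finS: "finite S" using S(1) finite_top finite_subset by blast
  \<comment> \<open>All top terms are at least \<open>\<alpha> m\<close>, so a nonempty sum equal to \<open>\<alpha> m\<close> is a single term.\<close>
  obtain p where p: "p \<in> S" using S(2) pos[of m] by (cases "S = {}") auto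
  have "y p \<le> \<alpha> m" using member_le_sum[of p S y] p finS y_pos S(2) by (simp add: less_imp_le)
  moreover have "p \<in> top_terms m" using p S(1) by blast
  ultimately have p: "p \<in> top_terms m" "y p = \<alpha> m" by auto
  have with_p: "sum y B' \<in> C (Suc m)" if B': "B' \<subseteq> top_terms m" "p \<in> B'" for B'
  proof -
    have "sum y B' \<in> D 0" using top_sum_add_D[OF B'(1) zero_in_D] by simp
    then obtain b e where b: "b \<in> C (Suc m)" "e \<in> D (Suc m)" "sum y B' = b + e"
      using D0_split[of "Suc m"] by blast
    obtain c j where c: "c \<in> C m" "j \<le> N m" "b = c + real j * \<alpha> m" using b(1) by auto
    have "e = 0"
    proof (rule ccontr)
      assume "e \<noteq> 0"
      then have e: "0 < e" using D_bounds[OF b(2)] by simp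
      have "j = N m"
        using top_sum_not_inside[OF rec B'(1) c(1) _ b(2) e] b(3) c(2,3) by (metis le_neq_implies_less)
      then have "j = Suc (N m - 1)" "N m - 1 < N m" using mult_pos[of m] by auto
      then obtain k where k: "j = Suc k" "k < N m" by blast
      have "sum y (B' - {p}) = sum y B' - y p"
        using B' finite_subset[OF B'(1) finite_top] by (simp add: sum_diff1)
      then have "sum y (B' - {p}) = c + real k * \<alpha> m + e"
        using b(3) c(3) p(2) k(1) by (simp add: algebra_simps)
      then show False using top_sum_not_inside[OF rec _ c(1) k(2) b(2) e, of "B' - {p}"] B'(1) by auto
    qed
    then show ?thesis using b by simp
  qed
  show ?thesis
  proof (cases "p \<in> B")
    case False
    have "sum y (top_terms m - B) = R 0 - R (Suc m) - sum y B"
      using sum_diff[OF finite_top B, of y] sum_top_terms[OF rec] by simp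
    then have "R 0 - R (Suc m) - sum y B \<in> C (Suc m)"
      using with_p[of "top_terms m - B"] False p(1) by auto
    then show ?thesis using C_reflect[of "R 0 - R (Suc m) - sum y B" "Suc m"] by simp
  qed (use with_p[OF B] in simp)
qed

lemma top_sums_eq_C:
  assumes "record_gap m"
  shows "sum y ` Pow (top_terms m) = C (Suc m)"
  using C_subset_top_sums[OF assms] top_sum_in_C[OF assms] by auto

end

section \<open>Counting and collisions\<close>

lemma factor_of_power_of_2:
  fixes a :: nat
  assumes "a \<ge> 1" "a + 1 dvd 2 ^ q"
  shows "\<exists>n\<ge>1. a = 2 ^ n - 1"
proof -
  obtain n where n: "a + 1 = 2 ^ n" using assms(2) divides_primepow_nat[of 2 "a + 1" q] by auto
  then have "n \<noteq> 0" using assms(1) by (cases n) auto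
  then show ?thesis using n by (intro exI[of _ n]) (auto simp: Suc_le_eq)
qed

context represented_blocks
begin

text \<open>With unique subsums the \<open>q\<close> top terms have \<open>2 ^ q\<close> sums, whereas \<open>C (Suc m)\<close> has
  \<open>(N 0 + 1) * \<dots> * (N m + 1)\<close> elements.\<close>

lemma unique_imp_binary:
  assumes "\<forall>t\<in>subsums y. \<exists>!A. infsum y A = t"
  shows "\<exists>n\<ge>1. N k = 2 ^ n - 1"
proof -
  obtain m where m: "k \<le> m" "record_gap m" using ex_record_gap by blast
  have "inj_on (sum y) (Pow (top_terms m))"
  proof (rule inj_onI)
    fix A B assume AB: "A \<in> Pow (top_terms m)" "B \<in> Pow (top_terms m)" "sum y A = sum y B"
    then have "finite A" "finite B" using finite_subset[OF _ finite_top] by auto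
    then have "infsum y A = infsum y B" using AB(3) by simp
    moreover have "infsum y B \<in> subsums y" unfolding subsums_def by blast
    ultimately show "A = B" using assms by metis
  qed
  then have "card (C (Suc m)) = 2 ^ card (top_terms m)"
    unfolding top_sums_eq_C[OF m(2), symmetric] by (simp add: card_image card_Pow finite_top)
  moreover have "N k + 1 dvd (\<Prod>i<Suc m. N i + 1)"
    by (rule dvd_prodI) (use m(1) in auto)
  ultimately have "N k + 1 dvd 2 ^ card (top_terms m)" unfolding card_C by (simp only:)
  then show ?thesis using factor_of_power_of_2 mult_pos by blast
qed

text \<open>Between two record gaps \<open>m < l\<close> lie finitely many terms of \<open>y\<close>. If their sums were distinct,
  comparing \<open>C (Suc l)\<close> with \<open>C (Suc m)\<close> would make \<open>N i + 1\<close> a power of two for every \<open>i\<close>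
  with \<open>m < i \<le> l\<close>.\<close>

lemma ex_collision:
  assumes rec: "record_gap m" and k: "m < k" "\<not> (\<exists>n\<ge>1. N k = 2 ^ n - 1)"
  shows "\<exists>B B'. B \<noteq> B' \<and> finite B \<and> finite B' \<and> B \<union> B' \<subseteq> small_terms m \<and> sum y B = sum y B'"
proof -
  obtain l where l: "k \<le> l" "record_gap l" using ex_record_gap by blast
  define K where "K = top_terms l - top_terms m"
  have finK: "finite K" unfolding K_def using finite_top by simp
  have top: "top_terms l = top_terms m \<union> K"
    using \<alpha>_antimono[of m l] k(1) l(1) unfolding K_def by auto
  have K_small: "B \<subseteq> small_terms m" if "B \<subseteq> K" for B
    using that unfolding K_def by auto
  have "\<not> inj_on (sum y) (Pow K)"
  proof
    assume inj: "inj_on (sum y) (Pow K)"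
    have eq: "C (Suc l) = (\<lambda>(c, s). c + s) ` (C (Suc m) \<times> sum y ` Pow K)"
    proof safe
      fix x assume "x \<in> C (Suc l)"
      then obtain B where B: "B \<subseteq> top_terms l" "x = sum y B"
        unfolding top_sums_eq_C[OF l(2), symmetric] by blast
      have "finite B" using B(1) finite_top finite_subset by blast
      then have "x = sum y (B \<inter> top_terms m) + sum y (B - top_terms m)"
        using B(2) sum.Int_Diff by blast
      moreover have "sum y (B \<inter> top_terms m) \<in> C (Suc m)" using top_sum_in_C[OF rec, of "B \<inter> top_terms m"] by simp
      moreover have "B - top_terms m \<subseteq> K" using B(1) unfolding K_def by blast
      ultimately show "x \<in> (\<lambda>(c, s). c + s) ` (C (Suc m) \<times> sum y ` Pow K)" by blast
    next
      fix c B assume "c \<in> C (Suc m)" and B: "B \<subseteq> K"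
      then obtain A where A: "A \<subseteq> top_terms m" "c = sum y A"
        unfolding top_sums_eq_C[OF rec, symmetric] by blast
      have "A \<inter> B = {}" using A(1) B unfolding K_def by blast
      moreover have "finite A" "finite B" using A(1) B finK finite_top finite_subset by blast+
      ultimately have "c + sum y B = sum y (A \<union> B)" by (simp add: A(2) sum.union_disjoint)
      then show "c + sum y B \<in> C (Suc l)"
        using top_sum_in_C[OF l(2), of "A \<union> B"] A(1) B unfolding top by auto
    qed
    have bound: "0 \<le> sum y B \<and> sum y B \<le> R (Suc m)" if "B \<subseteq> K" for B
      using infsum_y_mono[OF K_small[OF that]] infsum_small_terms[OF rec] infsum_y_nonneg[of B]
        finite_subset[OF that finK] by simp
    have "inj_on (\<lambda>(c, s). c + s) (C (Suc m) \<times> sum y ` Pow K)"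
    proof (rule inj_onI, clarify)
      fix c c' B B' assume *: "c \<in> C (Suc m)" "c' \<in> C (Suc m)" "B \<subseteq> K" "B' \<subseteq> K"
        "c + sum y B = c' + sum y B'"
      have "c = c'"
        using C_separated[OF *(1,2)] C_separated[OF *(2,1)] bound[OF *(3)] bound[OF *(4)] *(5)
        by linarith
      then show "c = c' \<and> sum y B = sum y B'" using *(5) by simp
    qed
    then have "card (C (Suc l)) = card (C (Suc m)) * 2 ^ card K"
      unfolding eq by (simp add: card_image card_cartesian_product inj card_Pow finK)
    moreover have "(\<Prod>i<Suc l. N i + 1) = (\<Prod>i<Suc m. N i + 1) * (\<Prod>i\<in>{Suc m..<Suc l}. N i + 1)"
      using prod.atLeastLessThan_concat[of 0 "Suc m" "Suc l" "\<lambda>i. N i + 1"] k(1) l(1)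
      by (simp only: lessThan_atLeast0)
    ultimately have "(\<Prod>i\<in>{Suc m..<Suc l}. N i + 1) = 2 ^ card K"
      unfolding card_C by simp
    moreover have "N k + 1 dvd (\<Prod>i\<in>{Suc m..<Suc l}. N i + 1)"
      by (rule dvd_prodI) (use k(1) l(1) in auto)
    ultimately show False using factor_of_power_of_2[OF mult_pos[of k]] k(2) by simp
  qed
  then obtain B B' where "B \<subseteq> K" "B' \<subseteq> K" "B \<noteq> B'" "sum y B = sum y B'"
    unfolding inj_on_def by blast
  then show ?thesis using K_small finK finite_subset by (metis Un_least)
qed

lemma infsum_y_UNION:
  assumes disj: "disjoint_family F" and fin: "\<And>n. finite (F n)"
  shows "infsum y (\<Union>n. F n) = infsum (\<lambda>n. sum y (F n)) UNIV"
proof -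
  have inj: "inj_on snd (Sigma UNIV F)"
    using disj unfolding disjoint_family_on_def by (intro inj_onI) (auto, blast)
  have img: "snd ` Sigma UNIV F = (\<Union>n. F n)" by force
  have "(y \<circ> snd) summable_on Sigma UNIV F"
    using summable_on_reindex[OF inj, of y] summable_on_y unfolding img by simp
  then have "infsum (\<lambda>n. infsum (\<lambda>i. (y \<circ> snd) (n, i)) (F n)) UNIV = infsum (y \<circ> snd) (Sigma UNIV F)"
    by (rule infsum_Sigma_banach)
  then show ?thesis using infsum_reindex[OF inj, of y] fin unfolding img by simp
qed

text \<open>If \<open>N k + 1\<close> is not a power of two for infinitely many \<open>k\<close>, there is a sequence
  of pairwise disjoint finite collisions \<open>sum y (B n) = sum y (B' n)\<close>. Choosing \<open>B n\<close> or \<open>B' n\<close> for every \<open>n\<close> independently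
  gives continuum many index sets with one and the same sum.\<close>

lemma ex_continuum_point:
  assumes "infinite {k. \<not> (\<exists>n\<ge>1. N k = 2 ^ n - 1)}"
  shows "\<exists>t\<in>subsums y. continuum_point y t"
proof -
  \<comment> \<open>A collision among the terms below the level \<open>m\<close>. The sequence is built so that each level lies
    below all terms used before.\<close>
  define P where "P m B B' \<longleftrightarrow> record_gap m \<and> B \<noteq> B' \<and> finite B \<and> finite B' \<and>
    B \<union> B' \<subseteq> small_terms m \<and> sum y B = sum y B'" for m B B'
  have collide: "\<exists>B B'. P m B B'" if rec: "record_gap m" for m
  proof -
    obtain k where "m < k" "\<not> (\<exists>n\<ge>1. N k = 2 ^ n - 1)"
      using assms unfolding infinite_nat_iff_unbounded by blast
    then show ?thesis using ex_collision[OF rec] rec unfolding P_def by simp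
  qed
  have "\<exists>f. \<forall>n. (case f n of (m, B, B') \<Rightarrow> P m B B') \<and>
    (case f n of (m, B, B') \<Rightarrow> case f (Suc n) of (m', B1, B1') \<Rightarrow>
      m \<le> m' \<and> (B \<union> B') \<inter> small_terms m' = {})"
  proof (rule dependent_nat_choice)
    obtain m where "record_gap m" using ex_record_gap[of 0] by blast
    then obtain B B' where "P m B B'" using collide by blast
    then show "\<exists>x. case x of (m, B, B') \<Rightarrow> P m B B'" by (intro exI[of _ "(m, B, B')"]) simp
  next
    fix x and n :: nat assume asm: "case x of (m, B, B') \<Rightarrow> P m B B'"
    obtain m B B' where x: "x = (m, B, B')" by (cases x)
    have "finite (B \<union> B')" using asm unfolding x P_def by simp
    then have "\<forall>\<^sub>F k in sequentially. \<forall>j\<in>B \<union> B'. \<alpha> k < y j"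
      by (rule eventually_ball_finite) (intro ballI order_tendstoD(2)[OF \<alpha>_tendsto y_pos])
    then obtain k0 where k0: "\<And>k j. k \<ge> k0 \<Longrightarrow> j \<in> B \<union> B' \<Longrightarrow> \<alpha> k < y j"
      unfolding eventually_sequentially by blast
    obtain m' where m': "max m k0 \<le> m'" "record_gap m'" using ex_record_gap[of "max m k0"] by blast
    obtain B1 B1' where "P m' B1 B1'" using collide[OF m'(2)] by blast
    moreover have "(B \<union> B') \<inter> small_terms m' = {}" using k0[of m'] m'(1) by (auto dest: less_asym)
    ultimately show "\<exists>x'. (case x' of (m, B, B') \<Rightarrow> P m B B') \<and>
        (case x of (m, B, B') \<Rightarrow> case x' of (m', B1, B1') \<Rightarrow>
          m \<le> m' \<and> (B \<union> B') \<inter> small_terms m' = {})"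
      using m'(1) unfolding x by (intro exI[of _ "(m', B1, B1')"]) simp
  qed
  then obtain f where f: "\<forall>n. (case f n of (m, B, B') \<Rightarrow> P m B B') \<and>
    (case f n of (m, B, B') \<Rightarrow> case f (Suc n) of (m', B1, B1') \<Rightarrow>
      m \<le> m' \<and> (B \<union> B') \<inter> small_terms m' = {})"
    by (rule exE)
  define l where "l n = fst (f n)" for n
  define B where "B n = fst (snd (f n))" for n
  define B' where "B' n = snd (snd (f n))" for n
  have fn: "f n = (l n, B n, B' n)" for n by (simp add: l_def B_def B'_def)
  have "P (l n) (B n) (B' n)"
    and next_level: "l n \<le> l (Suc n)" "(B n \<union> B' n) \<inter> small_terms (l (Suc n)) = {}" for n
    using f[rule_format, of n] unfolding fn by simp_all
  then have P: "B n \<noteq> B' n" "finite (B n)" "finite (B' n)" "B n \<union> B' n \<subseteq> small_terms (l n)"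
    "sum y (B n) = sum y (B' n)" for n
    unfolding P_def by blast+
  have l_mono: "l n \<le> l n'" if "n \<le> n'" for n n'
    by (rule lift_Suc_mono_le[of l, OF next_level(1) that])
  have separate: "(B n \<union> B' n) \<inter> (B n' \<union> B' n') = {}" if "n < n'" for n n'
  proof -
    have "small_terms (l n') \<subseteq> small_terms (l (Suc n))"
      using \<alpha>_antimono[OF l_mono[of "Suc n" n']] that by auto
    then show ?thesis using next_level(2)[of n] P(4)[of n'] by blast
  qed
  have disj: "(B n \<union> B' n) \<inter> (B n' \<union> B' n') = {}" if "n \<noteq> n'" for n n'
    using separate[of n n'] separate[of n' n] that by (metis inf_commute linorder_neqE_nat)
  define F where "F S n = (if n \<in> S then B n else B' n)" for S n
  define A where "A S = (\<Union>n. F S n)" for S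
  have F_sub: "F S n \<subseteq> B n \<union> B' n" for S n unfolding F_def by auto
  have sum_F: "sum y (F S n) = sum y (B n)" for S n using P(5)[of n] unfolding F_def by simp
  define t where "t = infsum (\<lambda>n. sum y (B n)) UNIV"
  have t: "infsum y (A S) = t" for S
  proof -
    have "disjoint_family (F S)" unfolding disjoint_family_on_def using disj F_sub by blast
    then show ?thesis
      unfolding A_def t_def using infsum_y_UNION[of "F S"] P(2,3) by (simp add: sum_F) (simp add: F_def)
  qed
  have "inj A"
  proof (rule injI)
    have F_eq: "F S n = A S \<inter> (B n \<union> B' n)" for S n
    proof -
      have "F S n' \<inter> (B n \<union> B' n) = {}" if "n' \<noteq> n" for n'
        using disj[OF that] F_sub[of S n'] by blast
      then have "F S n' \<inter> (B n \<union> B' n) \<subseteq> F S n" for n' by (cases "n' = n") auto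
      then show ?thesis unfolding A_def using F_sub[of S n] by blast
    qed
    fix S S' assume "A S = A S'"
    then have eq: "F S n = F S' n" for n unfolding F_eq by simp
    have "n \<in> S \<longleftrightarrow> n \<in> S'" for n
      using eq[of n] P(1)[of n] unfolding F_def by (auto split: if_splits)
    then show "S = S'" by blast
  qed
  then have "(UNIV :: nat set set) \<lesssim> {A. infsum y A = t}"
    unfolding lepoll_def using t by (intro exI[of _ A]) auto
  moreover have "{A. infsum y A = t} \<lesssim> (UNIV :: nat set set)" by (rule subset_imp_lepoll) simp
  ultimately have "{A. infsum y A = t} \<approx> (UNIV :: real set)"
    using lepoll_antisym nat_sets_eqpoll_reals eqpoll_trans by blast
  moreover have "t \<in> subsums y" unfolding subsums_def using t[of UNIV] by blast
  ultimately show ?thesis unfolding continuum_point_def by blast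
qed

end

section \<open>Construction of representations\<close>

text \<open>Block \<open>k\<close> is replaced by the \<open>p k\<close> terms \<open>v (k, i) * \<alpha> k\<close>, whose integer weights \<open>v (k, i)\<close> have
  exactly the subset sums \<open>0, \<dots>, N k\<close>; \<open>b\<close> enumerates the pairs \<open>(k, i)\<close>. The given sequence has
  unit weights. The resulting sequence \<open>z\<close> has the same subsums.\<close>

locale block_expansion = dominating_blocks +
  fixes p :: "nat \<Rightarrow> nat" and v :: "nat \<times> nat \<Rightarrow> nat" and b :: "nat \<Rightarrow> nat \<times> nat"
  assumes bij_b: "bij_betw b UNIV (Sigma UNIV (\<lambda>k. {..<p k}))"
    and block_sums: "(\<lambda>S. \<Sum>i\<in>S. v (k, i)) ` Pow {..<p k} = {..N k}"
begin

text \<open>The sequence of the new terms.\<close>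

definition z :: "nat \<Rightarrow> real" where
  "z n = real (v (b n)) * \<alpha> (fst (b n))"

text \<open>The digit at \<open>k\<close> of the subsum over the index set \<open>A\<close>: the total weight of the terms of block \<open>k\<close>
  that \<open>A\<close> selects.\<close>

definition digits :: "nat set \<Rightarrow> nat \<Rightarrow> nat" where
  "digits A k = (\<Sum>i | (k, i) \<in> b ` A. v (k, i))"

lemma slice_subset: "{i. (k, i) \<in> b ` A} \<subseteq> {..<p k}"
proof -
  have "b ` A \<subseteq> Sigma UNIV (\<lambda>k. {..<p k})" using bij_betwE[OF bij_b] by blast
  then show ?thesis by blast
qed

lemma sum_block: "S \<subseteq> {..<p k} \<Longrightarrow> (\<Sum>i\<in>S. v (k, i)) \<le> N k"
proof -
  assume "S \<subseteq> {..<p k}"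
  then have "(\<Sum>i\<in>S. v (k, i)) \<in> (\<lambda>S. \<Sum>i\<in>S. v (k, i)) ` Pow {..<p k}" by (intro imageI PowI)
  then show ?thesis unfolding block_sums by (rule atMost_iff[THEN iffD1])
qed

lemma digits_le: "digits A k \<le> N k"
  unfolding digits_def by (rule sum_block[OF slice_subset])

lemma summable_on_weights:
  "(\<lambda>x. real (v x) * \<alpha> (fst x)) summable_on Sigma UNIV (\<lambda>k. {..<p k})"
proof (rule summable_on_SigmaI)
  show "((\<lambda>i. real (v (k, i)) * \<alpha> (fst (k, i))) has_sum (real (\<Sum>i<p k. v (k, i)) * \<alpha> k)) {..<p k}" for k
    by (rule has_sum_finiteI) (auto simp: sum_distrib_right)
  have "summable (\<lambda>k. real (\<Sum>i<p k. v (k, i)) * \<alpha> k)"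
    by (rule summable_comparison_test'[OF summable_blocks, of 0])
      (use sum_block[OF order_refl] pos in \<open>auto simp: abs_mult less_imp_le simp del: of_nat_sum intro!: mult_right_mono\<close>)
  then show "(\<lambda>k. real (\<Sum>i<p k. v (k, i)) * \<alpha> k) summable_on UNIV"
    using pos by (subst summable_on_UNIV_nonneg_real_iff)
      (auto simp: less_imp_le simp del: of_nat_sum intro!: mult_nonneg_nonneg)
qed (auto simp: pos less_imp_le)

lemma summable_on_z: "z summable_on UNIV"
  using summable_on_reindex_bij_betw[OF bij_b, of "\<lambda>x. real (v x) * \<alpha> (fst x)"] summable_on_weights
  unfolding z_def[abs_def] by simp

lemma infsum_z: "infsum z A = tail (digits A) 0"
proof -
  let ?w = "\<lambda>x. real (v x) * \<alpha> (fst x)"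
  let ?S = "\<lambda>k. {i. (k, i) \<in> b ` A}"
  have fin: "finite (?S k)" for k using slice_subset by (rule finite_subset) simp
  have inj: "inj_on b A" using bij_b by (auto simp: bij_betw_def intro: inj_on_subset)
  have img: "b ` A = Sigma UNIV ?S" by auto
  have summ: "?w summable_on Sigma UNIV ?S"
    by (rule summable_on_subset_banach[OF summable_on_weights]) (use slice_subset in blast)
  have d: "infsum (\<lambda>i. ?w (k, i)) (?S k) = real (digits A k) * \<alpha> k" for k
    using fin[of k] by (simp add: digits_def sum_distrib_right)
  have "infsum z A = infsum ?w (b ` A)"
    using infsum_reindex[OF inj, of ?w] by (simp add: z_def[abs_def] o_def)
  also have "\<dots> = infsum ?w (Sigma UNIV ?S)" using img by (rule arg_cong)
  also have "\<dots> = infsum (\<lambda>k. infsum (\<lambda>i. ?w (k, i)) (?S k)) UNIV"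
    by (rule infsum_Sigma_banach[OF summ, symmetric])
  also have "\<dots> = infsum (\<lambda>k. real (digits A k) * \<alpha> k) UNIV" by (simp only: d)
  also have "\<dots> = (\<Sum>k. real (digits A k) * \<alpha> k)"
  proof -
    have "(\<lambda>k. real (digits A k) * \<alpha> k) summable_on UNIV"
      using summable_tail[of "digits A" 0] digits_le
      by (subst summable_on_UNIV_nonneg_real_iff) (simp_all add: pos less_imp_le)
    then show ?thesis by (rule sums_unique[OF has_sum_imp_sums[OF has_sum_infsum]])
  qed
  finally show ?thesis unfolding tail_def by simp
qed

lemma subsums_z: "subsums z = D 0"
proof
  show "subsums z \<subseteq> D 0" unfolding subsums_def D_def using infsum_z digits_le by blast
  show "D 0 \<subseteq> subsums z"
  proof
    fix x assume "x \<in> D 0"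
    then obtain c where c: "\<forall>k. c k \<le> N k" "x = tail c 0" unfolding D_def by blast
    have "\<exists>S. S \<subseteq> {..<p k} \<and> (\<Sum>i\<in>S. v (k, i)) = c k" for k
      using block_sums[of k] c(1) by (metis (no_types, lifting) PowD atMost_iff image_iff)
    then obtain S where S: "\<And>k. S k \<subseteq> {..<p k}" "\<And>k. (\<Sum>i\<in>S k. v (k, i)) = c k" by metis
    define A where "A = b -` Sigma UNIV S"
    have "Sigma UNIV S \<subseteq> range b"
      unfolding bij_betw_imp_surj_on[OF bij_b] by (rule Sigma_mono) (use S(1) in auto)
    then have "b ` A = Sigma UNIV S" unfolding A_def image_vimage_eq by (rule Int_absorb2)
    then have "digits A = c" unfolding digits_def using S(2) by auto
    then show "x \<in> subsums z" unfolding subsums_def c(2) using infsum_z[of A] by (intro CollectI exI[of _ A]) simp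
  qed
qed

text \<open>Equal sums have equal digits, so the index set is determined in every block whose weights have
  distinct subset sums.\<close>

lemma infsum_z_inj:
  assumes inj: "\<And>k. k \<notin> K \<Longrightarrow> inj_on (\<lambda>S. \<Sum>i\<in>S. v (k, i)) (Pow {..<p k})"
    and sums: "infsum z A = infsum z A'"
    and on_K: "b ` A \<inter> Sigma K (\<lambda>k. {..<p k}) = b ` A' \<inter> Sigma K (\<lambda>k. {..<p k})"
  shows "A = A'"
proof -
  have "digits A = digits A'"
    using digits_unique[of "digits A" "digits A'"] digits_le sums unfolding infsum_z by simp
  then have eq: "(\<Sum>i | (k, i) \<in> b ` A. v (k, i)) = (\<Sum>i | (k, i) \<in> b ` A'. v (k, i))" for k
    using fun_cong[of "digits A" "digits A'" k] unfolding digits_def by simp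
  have slices: "{i. (k, i) \<in> b ` A} = {i. (k, i) \<in> b ` A'}" for k
  proof (cases "k \<in> K")
    case True
    have slice: "{i. (k, i) \<in> b ` B} = {i. (k, i) \<in> b ` B \<inter> Sigma K (\<lambda>k. {..<p k})}" for B
    proof -
      have "i < p k" if "(k, i) \<in> b ` B" for i using slice_subset[of k B] that by blast
      then show ?thesis using True by (intro Collect_cong) (simp add: mem_Sigma_iff, blast)
    qed
    show ?thesis by (subst (1 2) slice) (simp only: on_K)
  next
    case False
    show ?thesis by (rule inj_onD[OF inj[OF False] eq]) (intro PowI slice_subset)+
  qed
  have "x \<in> b ` A \<longleftrightarrow> x \<in> b ` A'" for x
  proof -
    have "snd x \<in> {i. (fst x, i) \<in> b ` A} \<longleftrightarrow> snd x \<in> {i. (fst x, i) \<in> b ` A'}"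
      by (simp only: slices)
    then show ?thesis by (simp only: mem_Collect_eq prod.collapse)
  qed
  then have "b ` A = b ` A'" by (rule set_eqI)
  then show ?thesis using inj_image_eq_iff[OF bij_betw_imp_inj_on[OF bij_b]] by blast
qed

end

lemma binary_sums_inj: "inj_on (\<lambda>S. \<Sum>i\<in>S. (2::nat) ^ i) (Pow {..<n})"
proof (rule inj_onI)
  fix S T :: "nat set"
  assume "S \<in> Pow {..<n}" "T \<in> Pow {..<n}" and eq: "(\<Sum>i\<in>S. (2::nat) ^ i) = (\<Sum>i\<in>T. 2 ^ i)"
  then have "finite S" "finite T" using finite_subset[of _ "{..<n}"] by auto
  then show "S = T" using eq set_encode_eq unfolding set_encode_def by blast
qed

lemma binary_sums_image: "(\<lambda>S. \<Sum>i\<in>S. (2::nat) ^ i) ` Pow {..<n} = {..2 ^ n - 1}"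
proof (rule card_subset_eq)
  have total: "(\<Sum>i<n. (2::nat) ^ i) = 2 ^ n - 1" by (simp add: mask_eq_sum_exp_nat[symmetric] lessThan_def)
  show "(\<lambda>S. \<Sum>i\<in>S. (2::nat) ^ i) ` Pow {..<n} \<subseteq> {..2 ^ n - 1}"
    unfolding total[symmetric] by (auto intro!: sum_mono2)
  show "card ((\<lambda>S. \<Sum>i\<in>S. (2::nat) ^ i) ` Pow {..<n}) = card {..2 ^ n - 1 :: nat}"
    by (simp add: card_image[OF binary_sums_inj] card_Pow)
qed simp

lemma unary_sums_image: "(\<lambda>S. \<Sum>i\<in>S. (1::nat)) ` Pow {..<n} = {..n}"
proof
  show "(\<lambda>S. \<Sum>i\<in>S. (1::nat)) ` Pow {..<n} \<subseteq> {..n}"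
    using card_mono[of "{..<n}"] by fastforce
  show "{..n} \<subseteq> (\<lambda>S. \<Sum>i\<in>S. (1::nat)) ` Pow {..<n}"
  proof
    fix j assume "j \<in> {..n}"
    then show "j \<in> (\<lambda>S. \<Sum>i\<in>S. (1::nat)) ` Pow {..<n}"
      by (intro image_eqI[of _ _ "{..<j}"]) auto
  qed
qed

context dominating_blocks
begin

text \<open>Blocks with \<open>N k = 2 ^ n - 1\<close> get the weights \<open>1, 2, \<dots>, 2 ^ (n - 1)\<close>, the others (the bad
  ones) keep \<open>N k\<close> unit weights. An index set is then determined by its sum and its finitely many
  elements in bad blocks.\<close>

lemma ex_representation:
  fixes Bad :: "nat set"
  defines "Bad \<equiv> {k. \<not> (\<exists>n\<ge>1. N k = 2 ^ n - 1)}"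
  assumes "finite Bad"
  shows "\<exists>y. (\<forall>n. 0 < y n) \<and> summable y \<and> subsums y = D 0 \<and>
    (\<forall>t. finite {A. infsum y A = t}) \<and>
    (Bad = {} \<longrightarrow> (\<forall>A A'. infsum y A = infsum y A' \<longrightarrow> A = A'))"
proof -
  define e where "e k = (SOME n. n \<ge> 1 \<and> N k = 2 ^ n - 1)" for k
  have e: "e k \<ge> 1 \<and> N k = 2 ^ e k - 1" if "k \<notin> Bad" for k
    unfolding e_def by (rule someI_ex) (use that in \<open>simp add: Bad_def\<close>)
  define p where "p k = (if k \<in> Bad then N k else e k)" for k
  define v where "v = (\<lambda>(k, i). if k \<in> Bad then 1 else (2::nat) ^ i)"
  let ?S = "Sigma UNIV (\<lambda>k. {..<p k})"
  have "0 < p k" for k using e[of k] mult_pos[of k] unfolding p_def by auto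
  then have "range (\<lambda>k. (k, 0)) \<subseteq> ?S" by auto
  moreover have "infinite (range (\<lambda>k::nat. (k, 0::nat)))"
    by (subst finite_image_iff) (auto intro: inj_onI)
  ultimately have "infinite ?S" using finite_subset by blast
  then have bij: "bij_betw (from_nat_into ?S) UNIV ?S" by (intro bij_betw_from_nat_into) auto
  interpret block_expansion \<alpha> N p v "from_nat_into ?S"
  proof
    show "(\<lambda>S. \<Sum>i\<in>S. v (k, i)) ` Pow {..<p k} = {..N k}" for k
    proof (cases "k \<in> Bad")
      case True
      then show ?thesis using unary_sums_image[of "N k"] by (simp add: v_def p_def)
    next
      case False
      then show ?thesis using binary_sums_image[of "e k"] e[OF False] by (simp add: v_def p_def)
    qed
  qed (rule bij)
  let ?b = "from_nat_into ?S"
  have z_pos: "0 < z n" for n unfolding z_def using pos by (simp add: v_def split: prod.split)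
  have summable_z: "summable z" using summable_on_z by (rule summable_on_imp_summable)
  let ?T = "Sigma Bad (\<lambda>k. {..<p k})"
  have fiber: "A = A'"
    if "infsum z A = infsum z A'" "?b ` A \<inter> ?T = ?b ` A' \<inter> ?T" for A A'
  proof (rule infsum_z_inj[OF _ that])
    show "inj_on (\<lambda>S. \<Sum>i\<in>S. v (k, i)) (Pow {..<p k})" if "k \<notin> Bad" for k
      using binary_sums_inj[of "e k"] that by (simp add: v_def p_def)
  qed
  have "finite {A. infsum z A = t}" for t
  proof (rule inj_on_finite)
    show "inj_on (\<lambda>A. ?b ` A \<inter> ?T) {A. infsum z A = t}" by (rule inj_onI) (use fiber in auto)
    show "(\<lambda>A. ?b ` A \<inter> ?T) ` {A. infsum z A = t} \<subseteq> Pow ?T" by blast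
    show "finite (Pow ?T)" using \<open>finite Bad\<close> by simp
  qed
  moreover have "A = A'" if "Bad = {}" "infsum z A = infsum z A'" for A A'
    using fiber that by simp
  ultimately show ?thesis using z_pos summable_z subsums_z by (intro exI[of _ z]) simp
qed

end

section \<open>The block sequence\<close>

text \<open>Position \<open>n\<close> of the block sequence corresponds to the pair of its block and its place in it.\<close>

lemma block_index_bij:
  fixes N :: "nat \<Rightarrow> nat"
  assumes N: "\<And>k. N k \<ge> 1"
  shows "\<exists>b. bij_betw b UNIV (Sigma UNIV (\<lambda>k. {..<N k})) \<and>
    (\<forall>n. block_seq \<alpha> N n = \<alpha> (fst (b n)))"
proof -
  define blk where "blk n = (LEAST k. n < (\<Sum>i\<le>k. N i))" for n
  define s where "s k = (\<Sum>i<k. N i)" for k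
  have s_Suc: "s (Suc k) = s k + N k" for k by (simp add: s_def)
  have s_mono: "s i \<le> s j" if "i \<le> j" for i j
    using that by (rule lift_Suc_mono_le[of s, rotated]) (simp add: s_Suc)
  have blk: "blk n = (LEAST k. n < s (Suc k))" for n
    unfolding blk_def s_def by (simp add: lessThan_Suc_atMost)
  have grow: "n \<le> s n" for n
  proof (induction n)
    case (Suc n) then show ?case using N[of n] by (simp add: s_Suc)
  qed simp
  have upper: "n < s (Suc (blk n))" for n
    unfolding blk by (rule LeastI[of _ n]) (use grow[of "Suc n"] in simp)
  have lower: "s (blk n) \<le> n" for n
  proof (cases "blk n")
    case (Suc k)
    then have "\<not> n < s (Suc k)" unfolding blk by (intro not_less_Least) simp
    then show ?thesis using Suc by simp
  qed (simp add: s_def)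
  have unique: "blk n = k" if "s k \<le> n" "n < s (Suc k)" for n k
    unfolding blk
  proof (rule Least_equality)
    fix j assume "n < s (Suc j)"
    then show "k \<le> j" using that s_mono[of "Suc j" k] by (meson not_less_eq_eq leD le_less_trans)
  qed (rule that)
  have inverse: "blk (s k + i) = k" if "i < N k" for k i
    by (rule unique) (use that in \<open>simp_all add: s_Suc\<close>)
  have "bij_betw (\<lambda>n. (blk n, n - s (blk n))) UNIV (Sigma UNIV (\<lambda>k. {..<N k}))"
  proof (rule bij_betw_byWitness[where f' = "\<lambda>(k, i). s k + i"])
    show "\<forall>n\<in>UNIV. (case (blk n, n - s (blk n)) of (k, i) \<Rightarrow> s k + i) = n" using lower by simp
    show "\<forall>x\<in>Sigma UNIV (\<lambda>k. {..<N k}). (blk (case x of (k, i) \<Rightarrow> s k + i),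
        (case x of (k, i) \<Rightarrow> s k + i) - s (blk (case x of (k, i) \<Rightarrow> s k + i))) = x"
      using inverse by auto
    show "range (\<lambda>n. (blk n, n - s (blk n))) \<subseteq> Sigma UNIV (\<lambda>k. {..<N k})"
      using lower upper by (auto simp: s_Suc less_diff_conv2 add.commute)
    show "(\<lambda>(k, i). s k + i) ` Sigma UNIV (\<lambda>k. {..<N k}) \<subseteq> UNIV" by simp
  qed
  moreover have "block_seq \<alpha> N n = \<alpha> (fst (blk n, n - s (blk n)))" for n
    unfolding block_seq_def blk_def by simp
  ultimately show ?thesis by (intro exI[of _ "\<lambda>n. (blk n, n - s (blk n))"]) simp
qed

text \<open>The terms smaller than the value of block \<open>k\<close> are those of the later blocks, so the defining
  inequality of semi-fast convergence becomes the inequality between \<open>\<alpha> k\<close> and the blocks after it.\<close>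

lemma semi_fast_blocks_dominating:
  assumes "semi_fast_blocks \<alpha> N"
  shows "dominating_blocks \<alpha> N"
proof -
  let ?x = "block_seq \<alpha> N"
  let ?S = "\<lambda>I. Sigma I (\<lambda>k. {..<N k})"
  have dec: "\<And>i j. i < j \<Longrightarrow> \<alpha> j < \<alpha> i" and N: "\<And>k. N k \<ge> 1"
    and x_pos: "\<And>n. 0 < ?x n" and x_sum: "\<And>n. ?x summable_on {k. ?x k < ?x n}"
    and x_less: "\<And>n. infsum ?x {k. ?x k < ?x n} < ?x n"
    using assms unfolding semi_fast_blocks_def semi_fast_convergent_def by auto
  obtain b where bij: "bij_betw b UNIV (?S UNIV)" and x: "\<And>n. ?x n = \<alpha> (fst (b n))"
    using block_index_bij[of N \<alpha>, OF N] by blast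
  have \<alpha>_less: "\<alpha> i < \<alpha> j \<longleftrightarrow> j < i" for i j
    using dec[of i j] dec[of j i] by (metis less_asym linorder_neqE_nat order_less_irrefl)
  have block: "(\<lambda>k. real (N k) * \<alpha> k) summable_on {k<..} \<and>
      infsum (\<lambda>k. real (N k) * \<alpha> k) {k<..} < \<alpha> k \<and> 0 < \<alpha> k" for k
  proof -
    have "(k, 0) \<in> range b" using bij N[of k] unfolding bij_betw_def by auto
    then obtain n where n: "b n = (k, 0)" by (metis imageE)
    have bij_k: "bij_betw b {m. ?x m < ?x n} (?S {k<..})"
    proof (rule bij_betw_subset[OF bij])
      have "?x m < ?x n \<longleftrightarrow> b m \<in> ?S {k<..}" for m
      proof -
        obtain k' i where m: "b m = (k', i)" by (cases "b m")
        then have "i < N k'" using bij_betw_apply[OF bij UNIV_I, of m] by simp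
        then show ?thesis by (simp add: x m n \<alpha>_less)
      qed
      then have "{m. ?x m < ?x n} = b -` ?S {k<..}" unfolding vimage_def by (rule Collect_cong)
      then have "b ` {m. ?x m < ?x n} = ?S {k<..} \<inter> range b" by (simp only: image_vimage_eq)
      also have "\<dots> = ?S {k<..}" unfolding bij_betw_imp_surj_on[OF bij] by auto
      finally show "b ` {m. ?x m < ?x n} = ?S {k<..}" .
    qed simp
    have s: "(\<lambda>q. \<alpha> (fst q)) summable_on ?S {k<..}"
      using x_sum[of n] summable_on_reindex_bij_betw[OF bij_k, of "\<lambda>q. \<alpha> (fst q)"] unfolding x by simp
    have "infsum (\<lambda>q. \<alpha> (fst q)) (?S {k<..}) < \<alpha> k"
      using x_less[of n] infsum_reindex_bij_betw[OF bij_k, of "\<lambda>q. \<alpha> (fst q)"] n unfolding x by simp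
    then show ?thesis
      using summable_on_Sigma_banach[of "\<lambda>i j. \<alpha> i" "{k<..}" "\<lambda>k. {..<N k}"]
        infsum_Sigma_banach[OF s] s x_pos[of n] n x[of n] by (simp add: case_prod_unfold)
  qed
  have nonneg: "0 \<le> real (N k) * \<alpha> k" for k using block[of k] by simp
  have "(\<lambda>k. real (N k) * \<alpha> k) summable_on ({0<..} \<union> {0})"
    by (rule summable_on_union) (use block[of 0] in auto)
  moreover have "{0<..} \<union> {0} = (UNIV :: nat set)" by auto
  ultimately have summ: "summable (\<lambda>k. real (N k) * \<alpha> k)"
    by (simp add: summable_on_UNIV_nonneg_real_iff[OF nonneg])
  show ?thesis
  proof
    fix k
    have bij_shift: "bij_betw (\<lambda>i. i + Suc k) UNIV {k<..}"
      by (rule bij_betw_byWitness[where f' = "\<lambda>i. i - Suc k"]) auto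
    let ?f = "\<lambda>i. real (N (i + Suc k)) * \<alpha> (i + Suc k)"
    have "?f summable_on UNIV"
      using summable_on_reindex_bij_betw[OF bij_shift, of "\<lambda>k. real (N k) * \<alpha> k"] block[of k] by simp
    then have "suminf ?f = infsum ?f UNIV"
      by (rule sums_unique[OF has_sum_imp_sums[OF has_sum_infsum], symmetric])
    then show "suminf ?f < \<alpha> k"
      using infsum_reindex_bij_betw[OF bij_shift, of "\<lambda>k. real (N k) * \<alpha> k"] block[of k] by simp
  qed (use block N summ in auto)
qed

lemma subsums_block_seq:
  assumes "dominating_blocks \<alpha> N"
  shows "subsums (block_seq \<alpha> N) = dominating_blocks.D \<alpha> N 0"
proof -
  interpret dominating_blocks \<alpha> N by fact
  obtain b where bij: "bij_betw b UNIV (Sigma UNIV (\<lambda>k. {..<N k}))"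
    and x: "\<And>n. block_seq \<alpha> N n = \<alpha> (fst (b n))"
    using block_index_bij[of N \<alpha>, OF mult_pos] by blast
  interpret block_expansion \<alpha> N N "\<lambda>_. 1" b
    by standard (rule bij, rule unary_sums_image)
  have "block_seq \<alpha> N = z" unfolding z_def by (simp add: x fun_eq_iff)
  then show ?thesis using subsums_z by simp
qed

section \<open>Unique and slim representations\<close>

theorem theorem9p2:
  fixes \<alpha> :: "nat \<Rightarrow> real" and N :: "nat \<Rightarrow> nat"
  assumes "semi_fast_blocks \<alpha> N"
  shows "(has_unique_representation \<alpha> N \<longleftrightarrow> (\<forall>k. \<exists>n\<ge>1. N k = 2 ^ n - 1)) \<and>
         (has_slim_representation \<alpha> N \<longleftrightarrow> finite {k. \<not> (\<exists>n\<ge>1. N k = 2 ^ n - 1)})"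
proof -
  interpret dominating_blocks \<alpha> N by (rule semi_fast_blocks_dominating[OF assms])
  have rep: "is_representation y \<alpha> N \<longleftrightarrow> (\<forall>n. 0 < y n) \<and> summable y \<and> subsums y = D 0" for y
    unfolding is_representation_def subsums_block_seq[OF dominating_blocks_axioms] ..
  have repI: "represented_blocks \<alpha> N y" if "is_representation y \<alpha> N" for y
    using that unfolding rep by unfold_locales auto
  let ?Bad = "{k. \<not> (\<exists>n\<ge>1. N k = 2 ^ n - 1)}"
  have unique: "has_unique_representation \<alpha> N \<longleftrightarrow> (\<forall>k. \<exists>n\<ge>1. N k = 2 ^ n - 1)"
  proof
    assume "has_unique_representation \<alpha> N"
    then show "\<forall>k. \<exists>n\<ge>1. N k = 2 ^ n - 1"
      unfolding has_unique_representation_def using represented_blocks.unique_imp_binary[OF repI] by blast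
  next
    assume "\<forall>k. \<exists>n\<ge>1. N k = 2 ^ n - 1"
    then have "?Bad = {}" by simp
    then obtain y where y: "is_representation y \<alpha> N" "\<And>A A'. infsum y A = infsum y A' \<Longrightarrow> A = A'"
      using ex_representation rep by auto
    have "\<exists>!A. infsum y A = t" if "t \<in> subsums y" for t
      using that y(2) unfolding subsums_def by blast
    then show "has_unique_representation \<alpha> N"
      unfolding has_unique_representation_def using y(1) by blast
  qed
  have slim: "has_slim_representation \<alpha> N \<longleftrightarrow> finite ?Bad"
  proof
    assume "has_slim_representation \<alpha> N"
    then show "finite ?Bad"
      unfolding has_slim_representation_def using represented_blocks.ex_continuum_point[OF repI] by blast
  next
    assume "finite ?Bad"
    from ex_representation[OF this] obtain y where *: "\<forall>n. 0 < y n" "summable y" "subsums y = D 0"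
      and y: "\<forall>t. finite {A. infsum y A = t}"
      by (elim exE conjE) (rule that)
    have "\<not> continuum_point y t" for t
      unfolding continuum_point_def using y eqpoll_finite_iff[of _ "UNIV :: real set"] infinite_UNIV_char_0 by blast
    then show "has_slim_representation \<alpha> N"
      unfolding has_slim_representation_def rep using * by blast
  qed
  show ?thesis using unique slim ..
qed

end
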